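(* Let $X$ be a real Hilbert space, $A$ and $B$ closed subsets of $X$, $\delta>0$ and $q>0$. Suppose that $$\max\Big\{\|b-a\|^{q-2}d\big(b-a,N^F_A(a)\big),\ \|b-a\|^{-1}d\big(a-b,N^F_B(b)\big)\Big\}\ge\delta\tag{1}$$ for all $a\in A$ and $b\in B$ such that $d(b,A)>d(A,B)$. Then a sequence $(x_n)$ of alternating projections for $A$ and $B$ (with some initial point $x_0\in X$) satisfies $$\|x_{2n}-x_{2n-1}\|^q\le\|x_{2n-1}-x_{2n-2}\|^q-q\delta^2\|x_{2n-1}-x_{2n-2}\|$$ as long as $d(x_{2n-1},A)>d(A,B)$. Otherwise, $\|x_{2n}-x_{2n-1}\|=d(A,B)$, and the distance $d(A,B)$ is attained at $x_{2n-1}\in B$ and $x_{2n}\in A$. If $\delta<1$, then the condition $a\in A$ in the assumption part (i.e. in the requirement that (1) hold for all $a\in A$ and $b\in B$ with $d(b,A)>d(A,B)$) can be replaced with $a\in A\setminus B$.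
   Context: $X$ is not assumed finite dimensional and is identified with its dual. $d(x,S)$ is the distance from a point to a set and $d(A,B):=\inf_{a\in A,\,b\in B}\|a-b\|$. For $\Omega\subset X$ and $\omega\in\Omega$, the Fréchet normal cone is $$N^F_\Omega(\omega):=\Big\{x^*\in X\ \Big|\ \limsup_{\Omega\ni x\to\omega}\frac{\langle x^*,x-\omega\rangle}{\|x-\omega\|}\le0\Big\}.$$ A sequence of alternating projections is a sequence $(x_n)$ satisfying, with some initial point $x_0\in X$, the conditions $x_{2n-1}\in P_B(x_{2n-2})$ and $x_{2n}\in P_A(x_{2n-1})$ for $n=1,2,\ldots$, where $P_\Omega(x):=\{\omega\in\Omega:\|x-\omega\|=d(x,\Omega)\}$.
   Formalization: The decrease inequality is stated for n≥2, and for n=1 only if x_0∈A. For n=1 and x_0∉A it can fail: X=ℝ, A={0}, B=ℝ, δ≤1, x_0=1 satisfies (1), but x_1=1, x_2=0 would require 1≤0. *)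

theory Defs
  imports "HOL-Analysis.Analysis"
begin

text \<open>The limit superior is taken in the extended reals along \<open>at w within S\<close>, which excludes
  \<open>w\<close> itself. At an isolated point of \<open>S\<close> it equals \<open>-\<infinity>\<close>, so that the cone is the whole space.\<close>

definition frechet_normal_cone :: "'a::real_inner set \<Rightarrow> 'a \<Rightarrow> 'a set" where
  "frechet_normal_cone S w =
     {v. Limsup (at w within S) (\<lambda>x. ereal (inner v (x - w) / norm (x - w))) \<le> 0}"

definition metric_projection :: "'a::real_normed_vector set \<Rightarrow> 'a \<Rightarrow> 'a set" where
  "metric_projection S x = {w \<in> S. norm (x - w) = infdist x S}"

definition alternating_projections ::
  "'a::real_normed_vector set \<Rightarrow> 'a set \<Rightarrow> (nat \<Rightarrow> 'a) \<Rightarrow> bool" where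
  "alternating_projections A B x \<longleftrightarrow>
     (\<forall>n\<ge>1. x (2 * n - 1) \<in> metric_projection B (x (2 * n - 2)) \<and>
            x (2 * n) \<in> metric_projection A (x (2 * n - 1)))"

end

theory Submission imports Defs
begin

text \<open>
  Let \<open>b = x (2 * n - 1)\<close>, \<open>a\<^sub>0 = x (2 * n - 2)\<close> and \<open>r = norm (b - a\<^sub>0)\<close>. Since \<open>a\<^sub>0 - b\<close> is normal
  to \<open>B\<close> at \<open>b\<close>, the second term in the maximum is less than \<open>\<delta>\<close> at every \<open>a\<close> in the open ball
  of radius \<open>\<delta> * r\<close> around \<open>a\<^sub>0\<close>, so the first one is at least \<open>\<delta>\<close> there: on this ball
  the slope on \<open>A\<close> of \<open>norm (b - a) powr q\<close> is at least \<open>q * \<delta>\<close>, and the function must decrease by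
  \<open>q * \<delta> * (\<delta> * r)\<close>. If it did not, then adding a smooth function with gradient of norm less than
  \<open>q * \<delta>\<close> would produce, by the variational principle of Borwein and Preiss, a minimiser inside
  the ball that violates the slope bound. For \<open>\<delta> < 1\<close> the ball does not meet \<open>B\<close>, since \<open>r\<close> is the
  distance from \<open>a\<^sub>0\<close> to \<open>B\<close>.
\<close>

section \<open>Variational principle of Borwein and Preiss\<close>

text \<open>Provides the limits both of the approximate minimisers and of the gradients of the
  perturbation.\<close>

lemma convergent_geometric_increments:
  fixes y :: "nat \<Rightarrow> 'a::{real_normed_vector, complete_space}"
  assumes "\<And>n. norm (y (Suc n) - y n) \<le> C * (1/2)^n"
  shows "convergent y"
proof -
  have C: "C \<ge> 0"
    using order_trans[OF norm_ge_zero assms[of 0]] by simp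
  have *: "norm (y (n + k) - y n) \<le> 2 * C * ((1/2)^n - (1/2)^(n+k))" for n k
  proof (induction k)
    case (Suc k)
    have "norm (y (n + Suc k) - y n) \<le> norm (y (Suc (n+k)) - y (n+k)) + norm (y (n+k) - y n)"
      using norm_triangle_ineq[of "y (Suc (n+k)) - y (n+k)" "y (n+k) - y n"] by simp
    then show ?case
      using Suc assms[of "n+k"] by (simp add: algebra_simps)
  qed simp
  have bnd: "dist (y m) (y n) \<le> 2 * C * (1/2)^n" if "n \<le> m" for m n
  proof -
    obtain k where m: "m = n + k" using \<open>n \<le> m\<close> le_Suc_ex by blast
    have "2 * C * ((1/2)^n - (1/2)^(n+k)) \<le> 2 * C * (1/2)^n"
      using C by (intro mult_left_mono) auto
    then show ?thesis using *[of n k] by (simp add: m dist_norm)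
  qed
  have "(\<lambda>n. 2 * C * (1/2::real)^n) \<longlonglongrightarrow> 2 * C * 0"
    by (intro tendsto_intros LIMSEQ_power_zero) auto
  then have small: "\<forall>e>0. \<exists>N. \<forall>n\<ge>N. 2 * C * (1/2)^n < e"
    using order_tendstoD(2) by (fastforce simp: eventually_sequentially)
  have "Cauchy y"
    unfolding Cauchy_altdef
  proof (intro allI impI)
    fix e :: real assume "e > 0"
    then obtain N where N: "\<forall>n\<ge>N. 2 * C * (1/2)^n < e" using small by blast
    have "dist (y m) (y n) < e" if "m \<ge> N" "n > m" for m n
      using bnd[of m n] N that by (fastforce simp: dist_commute)
    then show "\<exists>M. \<forall>m\<ge>M. \<forall>n>m. dist (y m) (y n) < e" by blast
  qed
  then show ?thesis by (rule Cauchy_convergent)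
qed

text \<open>The perturbation is \<open>\<Sum>i. \<mu> i * (norm (z - w i))\<^sup>2\<close> for a sequence of approximate
  minimisers \<open>w i\<close>; expanding the squares around their limit gives the stated form.\<close>

lemma Borwein_Preiss:
  fixes h :: "'a::{real_inner, complete_space} \<Rightarrow> real"
  assumes "closed S" "bounded S" "S \<noteq> {}" "continuous_on S h" "bdd_below (h ` S)" "\<eta> > 0"
  obtains u v where "u \<in> S" "norm v \<le> \<eta>"
    "\<And>z. z \<in> S \<Longrightarrow> h u \<le> h z + v \<bullet> (z - u) + \<eta> * (norm (z - u))\<^sup>2"
proof -
  obtain D where D: "\<And>x y. x \<in> S \<Longrightarrow> y \<in> S \<Longrightarrow> norm (x - y) \<le> D"
    using \<open>bounded S\<close> unfolding bounded_two_points dist_norm by blast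
  have "D \<ge> 0" using D \<open>S \<noteq> {}\<close> norm_ge_zero order_trans by blast
  \<comment> \<open>The weights \<open>\<mu> i\<close> sum to at most \<open>2 * \<mu>0\<close>.
    Hence the quadratic coefficient is at most \<open>\<eta>\<close>, and so is the norm of the
    gradient, bounded by \<open>2 * (2 * \<mu>0) * D\<close>. The \<open>+ 1\<close> covers
    \<open>D = 0\<close>.\<close>
  define \<mu>0 where "\<mu>0 = \<eta> / (4 * (D + 1))"
  have \<mu>0: "\<mu>0 > 0" "4 * \<mu>0 * D \<le> \<eta>" "2 * \<mu>0 \<le> \<eta>"
    using \<open>D \<ge> 0\<close> \<open>\<eta> > 0\<close> by (auto simp: \<mu>0_def field_simps)
  define \<mu> where "\<mu> n = \<mu>0 * (1/2)^n" for n :: nat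
  \<comment> \<open>Tuned so that \<open>2 * \<epsilon> n = \<mu> n * ((1/2)^n)\<^sup>2\<close>,
    which bounds the step from \<open>w n\<close> to \<open>w (Suc n)\<close> by
    \<open>(1/2)^n\<close>.\<close>
  define \<epsilon> where "\<epsilon> n = \<mu>0 / 2 * (1/8)^n" for n :: nat
  have \<mu>pos: "\<mu> n > 0" and \<epsilon>pos: "\<epsilon> n > 0" for n
    using \<mu>0 by (auto simp: \<mu>_def \<epsilon>_def)
  have approx: "\<exists>w\<in>S. \<forall>z\<in>S. P w \<le> P z + e" if "bdd_below (P ` S)" "e > 0"
    for P :: "'a \<Rightarrow> real" and e
  proof -
    have "\<exists>p\<in>P ` S. p < Inf (P ` S) + e"
      using that \<open>S \<noteq> {}\<close> by (intro cInf_lessD) auto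
    then obtain w where "w \<in> S" "P w < Inf (P ` S) + e" by blast
    moreover have "Inf (P ` S) \<le> P z" if "z \<in> S" for z
      using \<open>bdd_below (P ` S)\<close> that by (simp add: cINF_lower)
    ultimately show ?thesis by force
  qed
  \<comment> \<open>Each penalty is centred at the point chosen before, so functions and points are
    built together by dependent choice.\<close>
  define Q where "Q n Pw \<longleftrightarrow> (n = 0 \<longrightarrow> fst Pw = h) \<and> bdd_below (fst Pw ` S) \<and> snd Pw \<in> S \<and>
      (\<forall>z\<in>S. fst Pw (snd Pw) \<le> fst Pw z + \<epsilon> n)" for n :: nat and Pw :: "('a \<Rightarrow> real) \<times> 'a"
  have "\<exists>f. \<forall>n. Q n (f n) \<and>
      fst (f (Suc n)) = (\<lambda>z. fst (f n) z + \<mu> n * (norm (z - snd (f n)))\<^sup>2)"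
  proof (rule dependent_nat_choice)
    show "\<exists>Pw. Q 0 Pw"
      using approx[OF assms(5) \<epsilon>pos[of 0]] assms(5) by (auto simp: Q_def)
  next
    fix Pw n assume "Q n Pw"
    define P' where "P' z = fst Pw z + \<mu> n * (norm (z - snd Pw))\<^sup>2" for z
    have bdd: "bdd_below (P' ` S)"
    proof -
      obtain m where "\<And>z. z \<in> S \<Longrightarrow> m \<le> fst Pw z"
        using \<open>Q n Pw\<close> by (auto simp: Q_def bdd_below_def)
      then have "m \<le> P' z" if "z \<in> S" for z
        using \<mu>pos[of n] that by (auto simp: P'_def intro: add_increasing2)
      then show ?thesis by (auto simp: bdd_below_def)
    qed
    from approx[OF bdd \<epsilon>pos[of "Suc n"]] obtain w where
      "w \<in> S" "\<forall>z\<in>S. P' w \<le> P' z + \<epsilon> (Suc n)" by blast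
    with bdd show "\<exists>Pw'. Q (Suc n) Pw' \<and>
        fst Pw' = (\<lambda>z. fst Pw z + \<mu> n * (norm (z - snd Pw))\<^sup>2)"
      by (intro exI[of _ "(P', w)"]) (auto simp: Q_def P'_def fun_eq_iff)
  qed
  then obtain f where fQ: "\<And>n. Q n (f n)"
    and fS: "\<And>n. fst (f (Suc n)) = (\<lambda>z. fst (f n) z + \<mu> n * (norm (z - snd (f n)))\<^sup>2)"
    by blast
  define P w where "P n = fst (f n)" and "w n = snd (f n)" for n
  have wS: "w n \<in> S" and wmin: "z \<in> S \<Longrightarrow> P n (w n) \<le> P n z + \<epsilon> n" for n z
    using fQ[of n] by (auto simp: Q_def P_def w_def)
  have P: "P n z = h z + (\<Sum>i<n. \<mu> i * (norm (z - w i))\<^sup>2)" for n z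
  proof (induction n)
    case 0
    then show ?case using fQ[of 0] by (simp add: Q_def P_def)
  next
    case (Suc n)
    then show ?case by (simp add: P_def w_def fS)
  qed
  have winc: "norm (w (Suc n) - w n) \<le> 1 * (1/2)^n" for n
  proof -
    \<comment> \<open>The new penalty vanishes at \<open>w n\<close>; adding the two approximate
      minimality inequalities isolates its value at \<open>w (Suc n)\<close>.\<close>
    have "P (Suc n) (w (Suc n)) \<le> P (Suc n) (w n) + \<epsilon> (Suc n)" using wmin wS by blast
    moreover have "P n (w n) \<le> P n (w (Suc n)) + \<epsilon> n" using wmin wS by blast
    ultimately have "\<mu> n * (norm (w (Suc n) - w n))\<^sup>2 \<le> \<epsilon> n + \<epsilon> (Suc n)" by (simp add: P)
    also have "\<dots> \<le> 2 * \<epsilon> n" using \<mu>0 by (simp add: \<epsilon>_def)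
    also have "\<dots> = \<mu> n * ((1/2)^n)\<^sup>2"
      by (simp add: \<epsilon>_def \<mu>_def power2_eq_square flip: power_mult_distrib)
    finally have "(norm (w (Suc n) - w n))\<^sup>2 \<le> ((1/2)^n)\<^sup>2"
      using \<mu>pos[of n] by simp
    then have "norm (w (Suc n) - w n) \<le> (1/2)^n" by (rule power2_le_imp_le) simp
    then show ?thesis by simp
  qed
  obtain u where u: "w \<longlonglongrightarrow> u"
    using convergent_geometric_increments[OF winc] convergent_def by blast
  have "u \<in> S" using closed_sequentially[OF \<open>closed S\<close> _ u] wS by blast
  define M where "M n = (\<Sum>i<n. \<mu> i)" for n
  have M0: "M n \<ge> 0" for n using \<mu>pos by (simp add: M_def sum_nonneg less_imp_le)
  have M: "M n \<le> 2 * \<mu>0" for n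
  proof -
    have "M n = 2 * \<mu>0 * (1 - (1/2)^n)"
      by (induction n) (auto simp: M_def \<mu>_def algebra_simps)
    then show ?thesis using \<mu>0 by simp
  qed
  \<comment> \<open>The gradient at \<open>w n\<close> of the sum of the first \<open>n\<close>
    penalties.\<close>
  define v where "v n = 2 *\<^sub>R (\<Sum>i<n. \<mu> i *\<^sub>R (w n - w i))" for n
  have vinc: "norm (v (Suc n) - v n) \<le> (2 * \<eta>) * (1/2)^n" for n
  proof -
    \<comment> \<open>Moving the base point shifts all differences by the same vector, which is also
      the difference in the new term; so the increments of \<open>v\<close> are controlled by those
      of \<open>w\<close>.\<close>
    have "(\<Sum>i<n. \<mu> i *\<^sub>R (w (Suc n) - w i)) - (\<Sum>i<n. \<mu> i *\<^sub>R (w n - w i))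
        = M n *\<^sub>R (w (Suc n) - w n)"
      by (simp add: M_def scaleR_sum_left flip: sum_subtractf scaleR_diff_right)
    then have sum_eq: "(\<Sum>i<n. \<mu> i *\<^sub>R (w (Suc n) - w i))
        = (\<Sum>i<n. \<mu> i *\<^sub>R (w n - w i)) + M n *\<^sub>R (w (Suc n) - w n)"
      by (simp only: diff_eq_eq add.commute)
    have "v (Suc n) - v n = 2 *\<^sub>R (M (Suc n) *\<^sub>R (w (Suc n) - w n))"
      by (simp add: v_def M_def sum_eq[unfolded M_def] scaleR_add_left scaleR_add_right
          del: scaleR_scaleR)
    then have "norm (v (Suc n) - v n) = 2 * (M (Suc n) * norm (w (Suc n) - w n))"
      using M0[of "Suc n"] by simp
    also have "\<dots> \<le> 2 * (\<eta> * (1 * (1/2)^n))"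
      using M[of "Suc n"] \<mu>0 winc[of n] \<open>\<eta> > 0\<close> by (intro mult_left_mono mult_mono) auto
    finally show ?thesis by simp
  qed
  obtain v0 where v0: "v \<longlonglongrightarrow> v0"
    using convergent_geometric_increments[OF vinc] convergent_def by blast
  have "norm (v n) \<le> \<eta>" for n
  proof -
    have "norm (\<Sum>i<n. \<mu> i *\<^sub>R (w n - w i)) \<le> (\<Sum>i<n. \<mu> i * D)"
      using D wS \<mu>pos by (intro sum_norm_le) (simp add: less_imp_le)
    also have "\<dots> = M n * D" by (simp add: M_def sum_distrib_right)
    also have "\<dots> \<le> 2 * \<mu>0 * D" using M \<open>D \<ge> 0\<close> by (rule mult_right_mono)
    finally show ?thesis using \<mu>0 by (simp add: v_def)
  qed
  then have "norm v0 \<le> \<eta>"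
    using LIMSEQ_le_const2[OF tendsto_norm[OF v0]] by blast
  moreover have "h u \<le> h z + v0 \<bullet> (z - u) + \<eta> * (norm (z - u))\<^sup>2" if "z \<in> S" for z
  proof -
    have sq: "(norm (z - w i))\<^sup>2 - (norm (w n - w i))\<^sup>2
        = (norm (z - w n))\<^sup>2 + 2 * ((w n - w i) \<bullet> (z - w n))" for n i
      by (simp add: power2_norm_eq_inner algebra_simps inner_commute)
    have le: "h (w n) \<le> h z + v n \<bullet> (z - w n) + \<eta> * (norm (z - w n))\<^sup>2 + \<epsilon> n" for n
    proof -
      have "h (w n) \<le> h z + (\<Sum>i<n. \<mu> i * ((norm (z - w i))\<^sup>2 - (norm (w n - w i))\<^sup>2)) + \<epsilon> n"
        using wmin[OF that, of n] by (simp add: P right_diff_distrib sum_subtractf)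
      also have "(\<Sum>i<n. \<mu> i * ((norm (z - w i))\<^sup>2 - (norm (w n - w i))\<^sup>2))
          = M n * (norm (z - w n))\<^sup>2 + v n \<bullet> (z - w n)"
        by (simp add: sq v_def M_def distrib_left sum.distrib inner_sum_left sum_distrib_left
            sum_distrib_right mult.left_commute)
      also have "M n * (norm (z - w n))\<^sup>2 \<le> \<eta> * (norm (z - w n))\<^sup>2"
        using M[of n] \<mu>0 by (intro mult_right_mono) auto
      finally show ?thesis by simp
    qed
    have hlim: "(\<lambda>n. h (w n)) \<longlonglongrightarrow> h u"
      using continuous_on_tendsto_compose[OF assms(4) u \<open>u \<in> S\<close>] wS by simp
    have "\<epsilon> \<longlonglongrightarrow> \<mu>0 / 2 * 0"
      unfolding \<epsilon>_def by (intro tendsto_intros LIMSEQ_power_zero) auto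
    then have "(\<lambda>n. h z + v n \<bullet> (z - w n) + \<eta> * (norm (z - w n))\<^sup>2 + \<epsilon> n)
        \<longlonglongrightarrow> h z + v0 \<bullet> (z - u) + \<eta> * (norm (z - u))\<^sup>2 + \<mu>0 / 2 * 0"
      by (intro tendsto_intros u v0)
    from LIMSEQ_le[OF hlim this] le show ?thesis by auto
  qed
  ultimately show ?thesis using that \<open>u \<in> S\<close> by blast
qed

section \<open>Frechet normals and metric projections\<close>

text \<open>Fermat rule: where \<open>k z - k u\<close> is nonnegative,
  \<open>(- g) \<bullet> (z - u)\<close> is at most the first-order remainder, which is
  \<open>o(norm (z - u))\<close>.\<close>

lemma local_min_imp_normal:
  fixes k :: "'a::real_inner \<Rightarrow> real"
  assumes deriv: "(k has_derivative (\<lambda>y. g \<bullet> y)) (at u within S)"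
    and min: "eventually (\<lambda>z. k u \<le> k z) (at u within S)"
  shows "- g \<in> frechet_normal_cone S u"
proof -
  have lim: "((\<lambda>y. norm (k y - k u - g \<bullet> (y - u)) / norm (y - u)) \<longlongrightarrow> 0) (at u within S)"
    using deriv by (simp add: has_derivative_iff_norm)
  have "Limsup (at u within S) (\<lambda>z. ereal ((- g) \<bullet> (z - u) / norm (z - u))) \<le> 0"
    unfolding Limsup_le_iff
  proof (intro allI impI)
    fix y :: ereal assume "0 < y"
    then obtain e where e: "0 < ereal e" "ereal e < y" using ereal_dense2 by blast
    have "eventually (\<lambda>z. norm (k z - k u - g \<bullet> (z - u)) / norm (z - u) < e) (at u within S)"
      using order_tendstoD(2)[OF lim, of e] e by simp
    with min show "eventually (\<lambda>z. ereal ((- g) \<bullet> (z - u) / norm (z - u)) < y) (at u within S)"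
    proof eventually_elim
      case (elim z)
      have "(- g) \<bullet> (z - u) \<le> norm (k z - k u - g \<bullet> (z - u))" using elim(1) by simp
      then have "(- g) \<bullet> (z - u) / norm (z - u) \<le> norm (k z - k u - g \<bullet> (z - u)) / norm (z - u)"
        by (rule divide_right_mono) simp
      with elim(2) have "ereal ((- g) \<bullet> (z - u) / norm (z - u)) < ereal e" by simp
      then show ?case using e(2) by (rule less_trans)
    qed
  qed
  then show ?thesis by (simp add: frechet_normal_cone_def)
qed

text \<open>For \<open>t > 0\<close> a threshold \<open>e\<close> for the quotient becomes
  \<open>e / t\<close>; for \<open>t = 0\<close> the Fermat rule applies to a constant function.
  Whole rays thus serve as competitors in distances to the cone.\<close>

lemma frechet_normal_cone_scaleR:
  assumes "v \<in> frechet_normal_cone S w" "t \<ge> 0"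
  shows "t *\<^sub>R v \<in> frechet_normal_cone S w"
proof (cases "t = 0")
  case True
  have "((\<lambda>z. 0::real) has_derivative (\<lambda>y. 0 \<bullet> y)) (at w within S)" by simp
  from local_min_imp_normal[OF this] True show ?thesis by simp
next
  case False
  with assms have "t > 0" by simp
  have "Limsup (at w within S) (\<lambda>z. ereal ((t *\<^sub>R v) \<bullet> (z - w) / norm (z - w))) \<le> 0"
    unfolding Limsup_le_iff
  proof (intro allI impI)
    fix y :: ereal assume "0 < y"
    then obtain e where e: "0 < ereal e" "ereal e < y" using ereal_dense2 by blast
    have "eventually (\<lambda>z. ereal (v \<bullet> (z - w) / norm (z - w)) < ereal (e / t)) (at w within S)"
      using assms(1) e \<open>t > 0\<close> unfolding frechet_normal_cone_def mem_Collect_eq Limsup_le_iff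
      by (metis divide_pos_pos ereal_less(2))
    then show "eventually (\<lambda>z. ereal ((t *\<^sub>R v) \<bullet> (z - w) / norm (z - w)) < y) (at w within S)"
    proof eventually_elim
      case (elim z)
      then have "ereal ((t *\<^sub>R v) \<bullet> (z - w) / norm (z - w)) < ereal e"
        using \<open>t > 0\<close> by (simp add: pos_less_divide_eq mult.commute)
      then show ?case using e(2) by (rule less_trans)
    qed
  qed
  then show ?thesis by (simp add: frechet_normal_cone_def)
qed

text \<open>Fermat rule for half the squared distance to \<open>a\<close>, which \<open>b\<close>
  minimises over \<open>B\<close>. Unlike the norm it is smooth also at \<open>a\<close>, and its
  gradient at \<open>b\<close> is \<open>b - a\<close>.\<close>

lemma metric_projection_normal:
  fixes a b :: "'a::real_inner"
  assumes "b \<in> metric_projection B a"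
  shows "a - b \<in> frechet_normal_cone B b"
proof -
  have "((\<lambda>z. (z - a) \<bullet> (z - a) / 2) has_derivative (\<lambda>y. (b - a) \<bullet> y)) (at b within B)"
    by (auto intro!: derivative_eq_intros simp: inner_commute)
  moreover have "eventually (\<lambda>z. (b - a) \<bullet> (b - a) / 2 \<le> (z - a) \<bullet> (z - a) / 2) (at b within B)"
    unfolding eventually_at_filter
  proof (intro always_eventually allI impI)
    fix z assume "z \<in> B"
    then have "norm (b - a) \<le> norm (z - a)"
      using assms infdist_le[of z B a] by (auto simp: metric_projection_def dist_norm norm_minus_commute)
    then show "(b - a) \<bullet> (b - a) / 2 \<le> (z - a) \<bullet> (z - a) / 2"
      by (simp add: norm_le)
  qed
  ultimately have "- (b - a) \<in> frechet_normal_cone B b" by (rule local_min_imp_normal)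
  then show ?thesis by simp
qed

text \<open>For \<open>\<delta> \<le> 1\<close>, the ratio is at most the sine of the angle at \<open>b\<close> between \<open>u - b\<close> and
  \<open>a - b\<close>, because the cone contains the ray spanned by \<open>a - b\<close>; for \<open>\<delta> > 1\<close>, it is at most 1.\<close>

lemma infdist_normal_cone_near_projection:
  fixes a b u :: "'a::real_inner"
  assumes proj: "b \<in> metric_projection B a" and "a \<noteq> b" "u \<noteq> b"
    and near: "norm (u - a) < \<delta> * norm (a - b)"
  shows "inverse (norm (b - u)) * infdist (u - b) (frechet_normal_cone B b) < \<delta>"
proof -
  have "\<delta> > 0" using near \<open>a \<noteq> b\<close> norm_ge_zero[of "u - a"]
    by (meson le_less_trans zero_less_mult_pos2 zero_less_norm_iff right_minus_eq)
  have normal: "a - b \<in> frechet_normal_cone B b" using proj by (rule metric_projection_normal)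
  have le: "infdist (u - b) (frechet_normal_cone B b) \<le> norm (u - b - t *\<^sub>R (a - b))" if "t \<ge> 0" for t
    using infdist_le[OF frechet_normal_cone_scaleR[OF normal that], of "u - b"] by (simp add: dist_norm)
  have "infdist (u - b) (frechet_normal_cone B b) < \<delta> * norm (u - b)"
  proof (cases "\<delta> > 1")
    case True
    have "infdist (u - b) (frechet_normal_cone B b) \<le> 1 * norm (u - b)" using le[of 0] by simp
    also have "\<dots> < \<delta> * norm (u - b)" using True \<open>u \<noteq> b\<close> by (intro mult_strict_right_mono) auto
    finally show ?thesis .
  next
    case False
    define p r where "p = u - b" and "r = a - b"
    have pr: "norm p > 0" "norm r > 0" using assms by (auto simp: p_def r_def)
    have near': "norm (p - r) < \<delta> * norm r" using near by (simp add: p_def r_def)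
    have "(norm (p - r))\<^sup>2 < (\<delta> * norm r)\<^sup>2" using near' by (intro power_strict_mono) auto
    then have sq: "norm p ^ 2 - 2 * (p \<bullet> r) + norm r ^ 2 < \<delta>\<^sup>2 * norm r ^ 2"
      by (simp add: power2_norm_eq_inner inner_commute algebra_simps power_mult_distrib)
    have "\<delta>\<^sup>2 \<le> 1" using False \<open>\<delta> > 0\<close> by (simp add: power_le_one)
    then have "\<delta>\<^sup>2 * norm r ^ 2 \<le> norm r ^ 2" by (simp add: mult_left_le_one_le)
    \<comment> \<open>The angle is not obtuse, so the foot \<open>t *\<^sub>R r\<close> below lies
      on the ray spanned by \<open>r\<close> and not merely on the line.\<close>
    with sq have "p \<bullet> r \<ge> 0" using zero_le_power2[of "norm p"] by linarith
    define t where "t = (p \<bullet> r) / (norm r)\<^sup>2"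
    have "(norm (p - t *\<^sub>R r))\<^sup>2 = norm p ^ 2 - 2 * t * (p \<bullet> r) + t\<^sup>2 * norm r ^ 2"
      unfolding power2_norm_eq_inner by (simp add: inner_commute algebra_simps power2_eq_square)
    also have "\<dots> = norm p ^ 2 - (p \<bullet> r)\<^sup>2 / norm r ^ 2"
      using pr by (simp add: t_def field_simps power2_eq_square)
    finally have tr: "(norm (p - t *\<^sub>R r))\<^sup>2 * norm r ^ 2 = norm p ^ 2 * norm r ^ 2 - (p \<bullet> r)\<^sup>2"
      using pr by (simp add: field_simps)
    \<comment> \<open>The square \<open>(norm p ^ 2 - p \<bullet> r)\<^sup>2\<close> encodes that
      the distance from \<open>r\<close> to the line spanned by \<open>p\<close> is at most
      \<open>norm (p - r)\<close>. The sine is symmetric in \<open>p\<close> and \<open>r\<close>,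
      so this bounds the distance from \<open>p\<close> to the line spanned by
      \<open>r\<close>.\<close>
    have "norm p ^ 2 * (norm p ^ 2 - 2 * (p \<bullet> r) + norm r ^ 2) < norm p ^ 2 * (\<delta>\<^sup>2 * norm r ^ 2)"
      using sq pr by (intro mult_strict_left_mono) auto
    moreover have "norm p ^ 2 * norm p ^ 2 - 2 * norm p ^ 2 * (p \<bullet> r) + (p \<bullet> r)\<^sup>2 \<ge> 0"
      using zero_le_power2[of "norm p ^ 2 - p \<bullet> r"] by (simp add: power2_eq_square algebra_simps)
    ultimately have "(norm (p - t *\<^sub>R r))\<^sup>2 * norm r ^ 2 < (\<delta> * norm p)\<^sup>2 * norm r ^ 2"
      unfolding tr by (simp add: algebra_simps power_mult_distrib)
    then have "(norm (p - t *\<^sub>R r))\<^sup>2 < (\<delta> * norm p)\<^sup>2" using pr by simp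
    then have "norm (p - t *\<^sub>R r) < \<delta> * norm p"
      by (rule power2_less_imp_less) (use \<open>\<delta> > 0\<close> in simp)
    moreover have "t \<ge> 0" using \<open>p \<bullet> r \<ge> 0\<close> by (simp add: t_def)
    ultimately show ?thesis using le[of t] by (simp add: p_def r_def)
  qed
  then show ?thesis
    using \<open>u \<noteq> b\<close> by (simp add: norm_minus_commute inverse_eq_divide pos_divide_less_eq)
qed

section \<open>From a slope bound on \<open>A\<close> to a decrease\<close>

text \<open>Explains the weight \<open>norm (b - u) powr (q - 2)\<close> in the assumption: the
  gradient is \<open>q\<close> times this weight times \<open>u - b\<close>.\<close>

lemma has_derivative_norm_diff_powr:
  fixes b u :: "'a::real_inner"
  assumes "u \<noteq> b"
  shows "((\<lambda>z. norm (b - z) powr q) has_derivative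
           (\<lambda>y. - (q * norm (b - u) powr (q - 2)) *\<^sub>R (b - u) \<bullet> y)) (at u within S)"
proof -
  have pos: "norm (b - u) > 0" using assms by simp
  have "((\<lambda>z. norm (b - z)) has_derivative (\<lambda>y. (- y) \<bullet> sgn (b - u))) (at u)"
    using assms by (intro has_derivative_compose[OF _ has_derivative_norm])
      (auto intro!: derivative_eq_intros)
  then have "((\<lambda>z. norm (b - z) powr q) has_derivative
      (\<lambda>y. q * norm (b - u) powr (q - 1) * ((- y) \<bullet> sgn (b - u)))) (at u)"
    using pos by (auto intro!: derivative_eq_intros simp: powr_diff field_simps)
  moreover have "q * norm (b - u) powr (q - 1) * ((- y) \<bullet> sgn (b - u))
      = - (q * norm (b - u) powr (q - 2)) *\<^sub>R (b - u) \<bullet> y" for y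
    using pos by (simp add: powr_diff sgn_div_norm inner_commute power2_eq_square divide_inverse)
  ultimately show ?thesis by (simp only: has_derivative_at_withinI)
qed

lemma has_derivative_sqrt_norm_diff:
  fixes a u :: "'a::real_inner"
  assumes "e > 0"
  shows "((\<lambda>z. sqrt ((norm (z - a))\<^sup>2 + e\<^sup>2)) has_derivative
           (\<lambda>y. (1 / sqrt ((norm (u - a))\<^sup>2 + e\<^sup>2)) *\<^sub>R (u - a) \<bullet> y)) (at u within S)"
proof -
  have "(norm (u - a))\<^sup>2 + e\<^sup>2 > 0"
    using assms by (intro add_nonneg_pos) auto
  moreover have "((\<lambda>z. (norm (z - a))\<^sup>2 + e\<^sup>2) has_derivative (\<lambda>y. 2 * ((u - a) \<bullet> y))) (at u within S)"
    unfolding power2_norm_eq_inner by (auto intro!: derivative_eq_intros simp: inner_commute)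
  ultimately have "((\<lambda>z. sqrt ((norm (z - a))\<^sup>2 + e\<^sup>2)) has_derivative
      (\<lambda>y. 2 * ((u - a) \<bullet> y) * (inverse (sqrt ((norm (u - a))\<^sup>2 + e\<^sup>2)) / 2))) (at u within S)"
    by (rule has_derivative_real_sqrt)
  then show ?thesis by (simp add: inverse_eq_divide)
qed

text \<open>The square root is a smooth substitute for \<open>norm (w - a)\<close>, whose kink at \<open>a\<close> would be an
  obstacle to the Fermat rule.\<close>

lemma slope_decrease:
  fixes A :: "'a::{real_inner, complete_space} set"
  assumes "closed A" "a \<in> A" "b \<notin> A" "q > 0" "\<delta> > 0" "\<rho> > 0"
    and slope: "\<And>u. u \<in> A \<Longrightarrow> norm (u - a) < \<rho> \<Longrightarrow>
      norm (b - u) powr (q - 2) * infdist (b - u) (frechet_normal_cone A u) \<ge> \<delta>"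
  shows "infdist b A powr q \<le> norm (b - a) powr q - q * \<delta> * \<rho>"
proof (rule ccontr)
  assume contra: "\<not> ?thesis"
  define d where "d = norm (b - a) powr q - infdist b A powr q"
  have "d < q * \<delta> * \<rho>" using contra by (simp add: d_def)
  then have "max 0 (d / \<rho>) < q * \<delta>" using assms by (simp add: pos_divide_less_eq)
  \<comment> \<open>No decrease from \<open>a\<close> within \<open>A\<close> exceeds
    \<open>d\<close>. At distance \<open>\<rho>\<close> the penalty
    \<open>\<kappa> * norm (z - a)\<close> outweighs it, and yet its slope stays below
    \<open>q * \<delta>\<close>.\<close>
  then obtain \<kappa> where \<kappa>: "\<kappa> > 0" "d / \<rho> < \<kappa>" "\<kappa> < q * \<delta>" using dense by (metis max_less_iff_conj)
  have gap: "\<kappa> * \<rho> - d > 0" using \<kappa> \<open>\<rho> > 0\<close> by (simp add: pos_divide_less_eq)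
  \<comment> \<open>Since \<open>s a = e\<close>, smoothing costs half of the gap
    \<open>\<kappa> * \<rho> - d\<close>.\<close>
  define e where "e = (\<kappa> * \<rho> - d) / (2 * \<kappa>)"
  have e: "e > 0" "\<kappa> * e = (\<kappa> * \<rho> - d) / 2" using gap \<kappa> by (auto simp: e_def)
  \<comment> \<open>The first bound keeps \<open>\<kappa> + \<eta>\<close> below
    \<open>q * \<delta>\<close>; the second limits the cost of the perturbation to a third of the
    gap, so that together with the half spent on smoothing the total stays strictly below
    it.\<close>
  define \<eta> where "\<eta> = min ((q * \<delta> - \<kappa>) / 2) ((\<kappa> * \<rho> - d) / (3 * (\<rho> + \<rho>\<^sup>2)))"
  have r: "\<rho> + \<rho>\<^sup>2 > 0" using \<open>\<rho> > 0\<close> by (simp add: add_pos_pos)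
  have "\<eta> \<le> (q * \<delta> - \<kappa>) / 2" unfolding \<eta>_def by (rule min.cobounded1)
  moreover have "\<eta> > 0" using \<kappa> gap r by (simp add: \<eta>_def)
  ultimately have \<eta>: "\<kappa> + \<eta> < q * \<delta>" "\<eta> > 0" using \<kappa> by auto
  have "\<eta> * (\<rho> + \<rho>\<^sup>2) \<le> (\<kappa> * \<rho> - d) / (3 * (\<rho> + \<rho>\<^sup>2)) * (\<rho> + \<rho>\<^sup>2)"
    using r by (intro mult_right_mono) (auto simp: \<eta>_def)
  also have "\<dots> = (\<kappa> * \<rho> - d) / 3" using r by (simp del: distrib_left_numeral)
  finally have \<eta>2: "\<eta> * (\<rho> + \<rho>\<^sup>2) \<le> (\<kappa> * \<rho> - d) / 3" .
  define s where "s z = sqrt ((norm (z - a))\<^sup>2 + e\<^sup>2)" for z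
  have s_ge: "s z \<ge> norm (z - a)" for z by (simp add: s_def real_le_rsqrt)
  have s_pos: "s z > 0" for z using e by (simp add: s_def add_nonneg_pos)
  define h where "h z = norm (b - z) powr q + \<kappa> * s z" for z
  define S where "S = A \<inter> cball a \<rho>"
  have S: "closed S" "bounded S" "S \<noteq> {}" "a \<in> S" "S \<subseteq> A"
    using assms by (auto simp: S_def intro: closed_Int bounded_Int)
  have "continuous_on S h"
    unfolding h_def s_def using \<open>b \<notin> A\<close> \<open>S \<subseteq> A\<close> by (intro continuous_intros) auto
  moreover have "bdd_below (h ` S)"
    using \<kappa> s_pos by (auto simp: h_def intro!: bdd_belowI2[of _ 0] add_nonneg_nonneg intro: less_imp_le)
  ultimately obtain u v where "u \<in> S" and v: "norm v \<le> \<eta>"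
    and umin: "\<And>z. z \<in> S \<Longrightarrow> h u \<le> h z + v \<bullet> (z - u) + \<eta> * (norm (z - u))\<^sup>2"
    using Borwein_Preiss[OF S(1-3) _ _ \<eta>(2)] by blast
  have "u \<in> A" "u \<noteq> b" using \<open>u \<in> S\<close> \<open>b \<notin> A\<close> by (auto simp: S_def)
  have ua: "norm (a - u) \<le> \<rho>" using \<open>u \<in> S\<close> by (simp add: S_def dist_norm)
  have "infdist b A powr q \<le> norm (b - u) powr q"
    using infdist_le[OF \<open>u \<in> A\<close>, of b] \<open>q > 0\<close>
    by (intro powr_mono2) (auto simp: dist_norm infdist_nonneg)
  moreover have "v \<bullet> (a - u) \<le> \<eta> * \<rho>"
    using norm_cauchy_schwarz[of v "a - u"] mult_mono[OF v ua] \<eta> by simp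
  moreover have "\<eta> * (norm (a - u))\<^sup>2 \<le> \<eta> * \<rho>\<^sup>2"
    using ua \<eta> by (intro mult_left_mono power_mono) auto
  moreover have "\<kappa> * norm (u - a) \<le> \<kappa> * s u" using s_ge \<kappa> by simp
  moreover have "s a = e" using e by (simp add: s_def)
  \<comment> \<open>Minimality of \<open>u\<close> tested at \<open>a\<close>. The strict bound that
    follows puts \<open>u\<close> inside the open ball, so it is a local minimiser of the perturbed
    function on \<open>A\<close> and not only on \<open>S\<close>.\<close>
  ultimately have "\<kappa> * norm (u - a) \<le> d + \<kappa> * e + \<eta> * (\<rho> + \<rho>\<^sup>2)"
    using umin[OF \<open>a \<in> S\<close>] by (simp add: h_def d_def algebra_simps)
  then have "\<kappa> * norm (u - a) < \<kappa> * \<rho>" using e(2) \<eta>2 gap by argo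
  then have near: "norm (u - a) < \<rho>" using \<kappa> by simp
  define p where "p = (\<kappa> / s u) *\<^sub>R (u - a) + v"
  define c where "c = q * norm (b - u) powr (q - 2)"
  have "c > 0" using \<open>u \<noteq> b\<close> \<open>q > 0\<close> by (simp add: c_def)
  have "((\<lambda>z. h z + v \<bullet> (z - u) + \<eta> * ((z - u) \<bullet> (z - u))) has_derivative
      (\<lambda>y. (- c *\<^sub>R (b - u) + p) \<bullet> y)) (at u within A)"
  proof -
    have "((\<lambda>z. v \<bullet> (z - u) + \<eta> * ((z - u) \<bullet> (z - u))) has_derivative (\<lambda>y. v \<bullet> y)) (at u within A)"
      by (auto intro!: derivative_eq_intros)
    from has_derivative_add[OF has_derivative_add[OF has_derivative_norm_diff_powr[OF \<open>u \<noteq> b\<close>]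
        has_derivative_mult_right[OF has_derivative_sqrt_norm_diff[OF \<open>e > 0\<close>]]] this]
    show ?thesis
      unfolding h_def s_def p_def c_def add.assoc
      by (rule has_derivative_eq_rhs) (auto simp: inner_add_left inner_diff_left algebra_simps)
  qed
  moreover have "eventually (\<lambda>z. h u + v \<bullet> (u - u) + \<eta> * ((u - u) \<bullet> (u - u))
      \<le> h z + v \<bullet> (z - u) + \<eta> * ((z - u) \<bullet> (z - u))) (at u within A)"
    unfolding eventually_at
  proof (intro exI[of _ "\<rho> - norm (u - a)"] conjI ballI impI)
    fix z assume z: "z \<in> A" "z \<noteq> u \<and> dist z u < \<rho> - norm (u - a)"
    then have "dist a z \<le> \<rho>"
      using dist_triangle[of a z u] by (simp add: dist_norm norm_minus_commute)
    with z umin[of z] show "h u + v \<bullet> (u - u) + \<eta> * ((u - u) \<bullet> (u - u))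
      \<le> h z + v \<bullet> (z - u) + \<eta> * ((z - u) \<bullet> (z - u))"
      by (simp add: S_def power2_norm_eq_inner)
  qed (use near in simp)
  ultimately have "- (- c *\<^sub>R (b - u) + p) \<in> frechet_normal_cone A u"
    by (rule local_min_imp_normal)
  \<comment> \<open>Division by \<open>c\<close> turns the normal into
    \<open>b - u - (1 / c) *\<^sub>R p\<close>, at distance \<open>norm p / c\<close> from
    \<open>b - u\<close>.\<close>
  then have "(1 / c) *\<^sub>R (- (- c *\<^sub>R (b - u) + p)) \<in> frechet_normal_cone A u"
    using \<open>c > 0\<close> by (intro frechet_normal_cone_scaleR) auto
  from infdist_le[OF this, of "b - u"]
  have "infdist (b - u) (frechet_normal_cone A u) \<le> norm p / c"
    using \<open>c > 0\<close> by (simp add: dist_norm scaleR_diff_right scaleR_add_right)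
  then have "c * infdist (b - u) (frechet_normal_cone A u) \<le> norm p"
    using \<open>c > 0\<close> by (simp add: pos_le_divide_eq mult.commute)
  also have "\<dots> \<le> \<kappa> * (norm (u - a) / s u) + norm v"
    using norm_triangle_ineq[of "(\<kappa> / s u) *\<^sub>R (u - a)" v] \<kappa> s_pos[of u] by (simp add: p_def)
  also have "\<dots> \<le> \<kappa> * 1 + \<eta>"
    using s_ge[of u] s_pos[of u] \<kappa> v by (intro add_mono mult_left_mono) auto
  also have "\<dots> < q * \<delta>" using \<eta> by simp
  finally have "norm (b - u) powr (q - 2) * infdist (b - u) (frechet_normal_cone A u) < \<delta>"
    using \<open>q > 0\<close> by (simp add: c_def mult.assoc)
  with slope[OF \<open>u \<in> A\<close> near] show False by simp
qed

section \<open>Decrease along alternating projections\<close>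

text \<open>The disjunction covers both ranges of \<open>a\<close>. The decrease from
  \<open>x 0\<close> is claimed only for \<open>x 0\<close> in \<open>A\<close>: a start in
  \<open>B\<close> gives \<open>x 1 = x 0\<close>, and then the right-hand side is 0 while the
  left-hand side is positive if \<open>infdist (x 1) A > setdist A B\<close>.\<close>

theorem proposition5p4:
  fixes A B :: "'a::{real_inner, complete_space} set"
    and \<delta> q :: real
    and x :: "nat \<Rightarrow> 'a"
  assumes "closed A" and "closed B" and "\<delta> > 0" and "q > 0"
    and "(\<forall>a\<in>A. \<forall>b\<in>B. infdist b A > setdist A B \<longrightarrow>
            max (norm (b - a) powr (q - 2) * infdist (b - a) (frechet_normal_cone A a))
                (inverse (norm (b - a)) * infdist (a - b) (frechet_normal_cone B b)) \<ge> \<delta>)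
         \<or> (\<delta> < 1 \<and>
            (\<forall>a\<in>A - B. \<forall>b\<in>B. infdist b A > setdist A B \<longrightarrow>
            max (norm (b - a) powr (q - 2) * infdist (b - a) (frechet_normal_cone A a))
                (inverse (norm (b - a)) * infdist (a - b) (frechet_normal_cone B b)) \<ge> \<delta>))"
    and "alternating_projections A B x"
  shows "\<forall>n\<ge>1.
     (infdist (x (2 * n - 1)) A > setdist A B \<and> (n \<ge> 2 \<or> x 0 \<in> A) \<longrightarrow>
        norm (x (2 * n) - x (2 * n - 1)) powr q
          \<le> norm (x (2 * n - 1) - x (2 * n - 2)) powr q
             - q * \<delta>\<^sup>2 * norm (x (2 * n - 1) - x (2 * n - 2))) \<and>
     (\<not> infdist (x (2 * n - 1)) A > setdist A B \<longrightarrow>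
        norm (x (2 * n) - x (2 * n - 1)) = setdist A B \<and>
        x (2 * n - 1) \<in> B \<and> x (2 * n) \<in> A)"
proof (intro allI impI)
  fix n :: nat assume "n \<ge> 1"
  define a b a' where "a = x (2 * n - 2)" and "b = x (2 * n - 1)" and "a' = x (2 * n)"
  have bP: "b \<in> metric_projection B a" and aP: "a' \<in> metric_projection A b"
    using assms(6) \<open>n \<ge> 1\<close> unfolding alternating_projections_def a_def b_def a'_def by auto
  have "b \<in> B" "norm (a - b) = infdist a B" "a' \<in> A"
    using bP aP by (auto simp: metric_projection_def)
  have a'b: "norm (a' - b) = infdist b A"
    using aP by (auto simp: metric_projection_def norm_minus_commute)
  have "norm (a' - b) powr q \<le> norm (b - a) powr q - q * \<delta>\<^sup>2 * norm (b - a)"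
    if far: "infdist b A > setdist A B" and start: "n \<ge> 2 \<or> x 0 \<in> A"
  proof -
    have "a \<in> A"
    proof (cases "n \<ge> 2")
      case True
      then have "x (2 * (n - 1)) \<in> metric_projection A (x (2 * (n - 1) - 1))"
        using assms(6) unfolding alternating_projections_def by auto
      then show ?thesis by (simp add: a_def metric_projection_def right_diff_distrib')
    next
      case False
      with \<open>n \<ge> 1\<close> have "n = 1" by simp
      with start show ?thesis by (simp add: a_def)
    qed
    have "b \<notin> A" using far setdist_pos_le[of A B] by (metis infdist_zero not_less)
    then have "a \<noteq> b" using \<open>a \<in> A\<close> by auto
    have "norm (b - u) powr (q - 2) * infdist (b - u) (frechet_normal_cone A u) \<ge> \<delta>"
      if "u \<in> A" and near: "norm (u - a) < \<delta> * norm (a - b)" for u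
    proof -
      \<comment> \<open>Makes the second alternative of the assumption applicable at
        \<open>u\<close> as well.\<close>
      have "u \<notin> B" if "\<delta> < 1"
      proof
        assume "u \<in> B"
        then have "norm (a - b) \<le> norm (u - a)"
          using \<open>norm (a - b) = infdist a B\<close> infdist_le[of u B a]
          by (simp add: dist_norm norm_minus_commute)
        moreover have "\<delta> * norm (a - b) < 1 * norm (a - b)"
          using that \<open>a \<noteq> b\<close> by (intro mult_strict_right_mono) auto
        ultimately show False using near by simp
      qed
      then have "max (norm (b - u) powr (q - 2) * infdist (b - u) (frechet_normal_cone A u))
          (inverse (norm (b - u)) * infdist (u - b) (frechet_normal_cone B b)) \<ge> \<delta>"
        using assms(5) \<open>u \<in> A\<close> \<open>b \<in> B\<close> far by blast
      moreover have "u \<noteq> b" using \<open>u \<in> A\<close> \<open>b \<notin> A\<close> by auto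
      ultimately show ?thesis
        using infdist_normal_cone_near_projection[OF bP \<open>a \<noteq> b\<close> _ near] by auto
    qed
    \<comment> \<open>With \<open>\<rho> = \<delta> * norm (a - b)\<close> the decrease
      \<open>q * \<delta> * \<rho>\<close> is the claimed one.\<close>
    from slope_decrease[OF \<open>closed A\<close> \<open>a \<in> A\<close> \<open>b \<notin> A\<close> \<open>q > 0\<close> \<open>\<delta> > 0\<close> _ this]
    show ?thesis
      using \<open>a \<noteq> b\<close> \<open>\<delta> > 0\<close>
      by (simp add: a'b norm_minus_commute power2_eq_square mult.assoc)
  qed
  moreover have "norm (a' - b) = setdist A B" if "\<not> infdist b A > setdist A B"
    using that a'b setdist_le_dist[OF \<open>a' \<in> A\<close> \<open>b \<in> B\<close>] by (simp add: dist_norm)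
  ultimately show "(infdist (x (2 * n - 1)) A > setdist A B \<and> (n \<ge> 2 \<or> x 0 \<in> A) \<longrightarrow>
        norm (x (2 * n) - x (2 * n - 1)) powr q
          \<le> norm (x (2 * n - 1) - x (2 * n - 2)) powr q
             - q * \<delta>\<^sup>2 * norm (x (2 * n - 1) - x (2 * n - 2))) \<and>
     (\<not> infdist (x (2 * n - 1)) A > setdist A B \<longrightarrow>
        norm (x (2 * n) - x (2 * n - 1)) = setdist A B \<and>
        x (2 * n - 1) \<in> B \<and> x (2 * n) \<in> A)"
    using \<open>b \<in> B\<close> \<open>a' \<in> A\<close> unfolding a_def b_def a'_def by blast
qed

end
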